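(* Let $R$ be a ring of characteristic $p>0$, $I\subseteq R$ an ideal, and $s\geq 1$ a real number. For any $x\in R$, $x\in I^{\{s\}}$ if and only if $\overline{x}\in (I R/\mathfrak{p})^{\{s\}}$ for all minimal primes $\mathfrak{p}$ of $R$, where $\overline{x}$ denotes the image of $x$ in $R/\mathfrak{p}$ and the weak $s$-closure of $IR/\mathfrak{p}$ is taken in the ring $R/\mathfrak{p}$.
   Context: All rings are commutative and noetherian. For a ring $R$, $R^\circ$ denotes the set of elements of $R$ lying in no minimal prime of $R$. The letter $q$ denotes positive integer powers of $p$, and $q\gg 0$ means all sufficiently large such powers. $I^{[q]}=(f^q\mid f\in I)$ is the $q$th Frobenius power of $I$. For a real number $s\geq 1$, $I^{(s,q)}=I^{\lceil sq\rceil}+I^{[q]}$. The weak $s$-closure $I^{\{s\}}$ of an ideal $I$ of $R$ is the ideal of all $x\in R$ for which there exists $c\in R^\circ$ such that $cx^q\in I^{(s,q)}$ for all $q\gg 0$. *)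

theory Defs
  imports "HOL-Algebra.Algebra" "HOL-Computational_Algebra.Primes"
begin

definition ring_characteristic :: "('a, 'b) ring_scheme \<Rightarrow> nat" where
  "ring_characteristic R =
     (if \<exists>n>0. add_pow R (n::nat) \<one>\<^bsub>R\<^esub> = \<zero>\<^bsub>R\<^esub>
      then LEAST n. n > 0 \<and> add_pow R n \<one>\<^bsub>R\<^esub> = \<zero>\<^bsub>R\<^esub>
      else 0)"

definition minimal_prime :: "'a set \<Rightarrow> ('a, 'b) ring_scheme \<Rightarrow> bool" where
  "minimal_prime P R \<longleftrightarrow>
     primeideal P R \<and> (\<forall>Q. primeideal Q R \<longrightarrow> Q \<subseteq> P \<longrightarrow> Q = P)"

text \<open>The set usually written \<open>R\<close> with a superscript circle.\<close>

definition off_minimal_primes :: "('a, 'b) ring_scheme \<Rightarrow> 'a set" where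
  "off_minimal_primes R = {c \<in> carrier R. \<forall>P. minimal_prime P R \<longrightarrow> c \<notin> P}"

definition frobenius_power :: "('a, 'b) ring_scheme \<Rightarrow> 'a set \<Rightarrow> nat \<Rightarrow> 'a set" where
  "frobenius_power R I q = Idl\<^bsub>R\<^esub> {f [^]\<^bsub>R\<^esub> q | f. f \<in> I}"

text \<open>The ideal \<open>I\<^sup>(\<^sup>s\<^sup>,\<^sup>q\<^sup>)\<close>. The ordinary power of an ideal is its power in the
  multiplicative monoid of ideals, whose unit is the whole ring.\<close>

definition mixed_power :: "('a, 'b) ring_scheme \<Rightarrow> 'a set \<Rightarrow> real \<Rightarrow> nat \<Rightarrow> 'a set" where
  "mixed_power R I s q =
     (I [^]\<^bsub>ideals_set R\<^esub> nat \<lceil>s * real q\<rceil>) <+>\<^bsub>R\<^esub> frobenius_power R I q"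

text \<open>The weak \<open>s\<close>-closure of \<open>I\<close>, for a ring of characteristic \<open>p\<close>; \<open>q\<close> runs through
  the powers of \<open>p\<close> with positive exponent.\<close>

definition weak_closure :: "nat \<Rightarrow> ('a, 'b) ring_scheme \<Rightarrow> real \<Rightarrow> 'a set \<Rightarrow> 'a set" where
  "weak_closure p R s I =
     {x \<in> carrier R. \<exists>c \<in> off_minimal_primes R. \<exists>q0. \<forall>q\<ge>q0. (\<exists>e>0. q = p ^ e) \<longrightarrow>
        c \<otimes>\<^bsub>R\<^esub> (x [^]\<^bsub>R\<^esub> q) \<in> mixed_power R I s q}"

definition quotient_extension :: "('a, 'b) ring_scheme \<Rightarrow> 'a set \<Rightarrow> 'a set \<Rightarrow> 'a set set" where
  "quotient_extension R P I = Idl\<^bsub>R Quot P\<^esub> ((\<lambda>a. P +>\<^bsub>R\<^esub> a) ` I)"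

end

theory Submission
  imports Defs
begin

text \<open>Write \<open>I\<^sub>q\<close> for the mixed power of \<open>I\<close> at exponents \<open>s\<close> and \<open>q\<close>. The quotient map onto
\<open>R/P\<close> carries \<open>I\<^sub>q\<close> onto the corresponding mixed power of the extended ideal
(\<open>quotient_extension_mixed_power\<close>). For \<open>P\<close> minimal, membership of the image of \<open>x\<close> in the weak
closure over \<open>R/P\<close> therefore means: there is \<open>c \<notin> P\<close> with \<open>c x\<^sup>q \<in> I\<^sub>q + P\<close> for all large \<open>q\<close>
(\<open>mem_weak_closure_quotient_iff\<close>). A multiplier \<open>c\<close> that lies in no minimal prime and witnesses
\<open>x\<close> in the weak closure over \<open>R\<close> is a witness modulo each \<open>P\<close>, which gives one direction.

For the converse, let \<open>c\<^sub>P\<close> be a multiplier for each minimal prime \<open>P\<close>. There are only finitely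
many minimal primes, and they are pairwise incomparable, so there is an element \<open>t\<^sub>P \<notin> P\<close> lying in
all the others. The sum \<open>c\<close> of the products \<open>t\<^sub>P c\<^sub>P\<close> lies in no minimal prime, and
\<open>c x\<^sup>q \<in> I\<^sub>q + N\<close> for all large \<open>q\<close>, where \<open>N\<close> is the intersection of the minimal primes
(\<open>glue_multipliers\<close>).

It remains to remove \<open>N\<close>. Since \<open>R\<close> is noetherian, some power \<open>r\<close> of \<open>p\<close> satisfies \<open>n\<^sup>r = 0\<close> for
all \<open>n \<in> N\<close>. Taking \<open>r\<close>-th powers is additive in characteristic \<open>p\<close> and maps \<open>I\<^sub>q\<close> into
\<open>I\<^sub>q\<^sub>r\<close> (\<open>pow_mem_mixed_power\<close>), so \<open>c\<^sup>r x\<^sup>q\<^sup>r \<in> I\<^sub>q\<^sub>r\<close>. All large powers of \<open>p\<close> have the form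
\<open>q r\<close> with \<open>q\<close> large, and \<open>c\<^sup>r\<close> lies in no minimal prime because \<open>c\<close> does not.

The finiteness and the uniform nilpotency both come from one fact: in a noetherian ring zero is a
product of finitely many prime ideals (\<open>ideal_contains_prime_product\<close>).\<close>

section \<open>Additivity of the Frobenius map\<close>

lemma (in cring) binomial_theorem:
  fixes n :: nat
  assumes a: "a \<in> carrier R" and b: "b \<in> carrier R"
  shows "(a \<oplus> b) [^] n = (\<Oplus>k\<in>{..n}. add_pow R (n choose k) (a [^] k \<otimes> b [^] (n - k)))"
proof (induction n)
  case 0
  show ?case by simp
next
  case (Suc n)
  define t where "t m k = add_pow R (m choose k) (a [^] k \<otimes> b [^] (m - k))" for m k :: nat
  define u where "u k = add_pow R (n choose k) (a [^] Suc k \<otimes> b [^] (n - k))" for k :: nat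
  define v where "v k = add_pow R (n choose k) (a [^] k \<otimes> b [^] (Suc n - k))" for k :: nat
  have [simp]: "t m k \<in> carrier R" "u k \<in> carrier R" "v k \<in> carrier R" for m k
    using a b by (simp_all add: t_def u_def v_def)
  have ta: "t n k \<otimes> a = u k" for k
  proof -
    have "(a [^] k \<otimes> b [^] (n - k)) \<otimes> a = a [^] Suc k \<otimes> b [^] (n - k)"
      using a b by (simp add: m_ac)
    then show ?thesis using a b by (simp add: t_def u_def add_pow_ldistr)
  qed
  have tb: "t n k \<otimes> b = v k" if "k \<le> n" for k
    using a b that by (simp add: t_def v_def add_pow_ldistr Suc_diff_le m_assoc)
  have pascal: "t (Suc n) (Suc k) = u k \<oplus> v (Suc k)" for k
    using a b by (simp add: t_def u_def v_def add.nat_pow_mult)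
  have v_last: "v (Suc n) = \<zero>" and v_first: "v 0 = t (Suc n) 0"
    by (simp_all add: v_def t_def binomial_eq_0)
  have "(a \<oplus> b) [^] Suc n = (\<Oplus>k\<in>{..n}. t n k) \<otimes> (a \<oplus> b)"
    using Suc.IH by (simp add: t_def)
  also have "\<dots> = (\<Oplus>k\<in>{..n}. t n k \<otimes> a) \<oplus> (\<Oplus>k\<in>{..n}. t n k \<otimes> b)"
    using a b by (simp add: r_distr finsum_ldistr Pi_def)
  also have "(\<Oplus>k\<in>{..n}. t n k \<otimes> a) = (\<Oplus>k\<in>{..n}. u k)"
    by (simp add: ta)
  also have "(\<Oplus>k\<in>{..n}. t n k \<otimes> b) = (\<Oplus>k\<in>{..n}. v k)"
    by (rule finsum_cong') (simp_all add: tb Pi_def)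
  also have "(\<Oplus>k\<in>{..n}. v k) = (\<Oplus>k\<in>{..Suc n}. v k)"
    by (simp add: v_last Pi_def)
  also have "\<dots> = (\<Oplus>k\<in>{..n}. v (Suc k)) \<oplus> v 0"
    by (rule finsum_Suc2) (simp add: Pi_def)
  also have "(\<Oplus>k\<in>{..n}. u k) \<oplus> ((\<Oplus>k\<in>{..n}. v (Suc k)) \<oplus> v 0)
      = (\<Oplus>k\<in>{..n}. t (Suc n) (Suc k)) \<oplus> t (Suc n) 0"
    by (simp add: pascal finsum_addf Pi_def v_first a_assoc)
  also have "\<dots> = (\<Oplus>k\<in>{..Suc n}. t (Suc n) k)"
    by (rule finsum_Suc2[symmetric]) (simp add: Pi_def)
  finally show ?case by (simp add: t_def)
qed

lemma (in cring) multiple_of_characteristic_zero: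
  fixes p m :: nat
  assumes "add_pow R p \<one> = \<zero>" and "p dvd m" and y: "y \<in> carrier R"
  shows "add_pow R m y = \<zero>"
proof -
  obtain k where "m = p * k" using \<open>p dvd m\<close> ..
  then have "add_pow R m y = add_pow R k (add_pow R p (\<one> \<otimes> y))"
    using y by (simp add: add.nat_pow_pow)
  also have "add_pow R p (\<one> \<otimes> y) = \<zero>"
    using y assms(1) add_pow_ldistr[of \<one> y p] by simp
  finally show ?thesis by simp
qed

text \<open>The binomial coefficients strictly between the two ends of the \<open>p\<close>-th row are multiples of \<open>p\<close>,
so only the two extreme terms of the binomial expansion survive.\<close>

lemma (in cring) frobenius_add_prime:
  fixes p :: nat
  assumes p: "Factorial_Ring.prime p" and char: "add_pow R p \<one> = \<zero>"
    and a: "a \<in> carrier R" and b: "b \<in> carrier R"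
  shows "(a \<oplus> b) [^] p = a [^] p \<oplus> b [^] p"
proof -
  obtain m where m: "p = Suc (Suc m)"
    using prime_ge_2_nat[OF p] by (metis Suc_1 Suc_le_D Suc_le_mono One_nat_def)
  define t where "t k = add_pow R (p choose k) (a [^] k \<otimes> b [^] (p - k))" for k :: nat
  have t [simp]: "t k \<in> carrier R" for k
    using a b by (simp add: t_def)
  have middle: "t (Suc k) = \<zero>" if "k \<le> m" for k
  proof -
    have "p dvd p choose Suc k"
      by (rule dvd_choose_prime) (use that m p in auto)
    then show ?thesis
      unfolding t_def using a b by (intro multiple_of_characteristic_zero[OF char]) auto
  qed
  have "(a \<oplus> b) [^] p = (\<Oplus>k\<in>{..Suc (Suc m)}. t k)"
    using binomial_theorem[OF a b, of p] by (simp add: t_def m)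
  also have "\<dots> = t p \<oplus> ((\<Oplus>k\<in>{..m}. t (Suc k)) \<oplus> t 0)"
    by (subst finsum_Suc, simp add: Pi_def, subst finsum_Suc2) (simp_all add: Pi_def m)
  also have "(\<Oplus>k\<in>{..m}. t (Suc k)) = (\<Oplus>k\<in>{..m}. \<zero>)"
    by (rule finsum_cong') (simp_all add: middle)
  finally show ?thesis
    using a b by (simp add: t_def)
qed

lemma (in cring) frobenius_add:
  fixes p e :: nat
  assumes p: "Factorial_Ring.prime p" and char: "add_pow R p \<one> = \<zero>"
    and a: "a \<in> carrier R" and b: "b \<in> carrier R"
  shows "(a \<oplus> b) [^] (p ^ e) = a [^] (p ^ e) \<oplus> b [^] (p ^ e)"
proof (induction e)
  case 0
  then show ?case using a b by simp
next
  case (Suc e)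
  have "y [^] (p ^ Suc e) = (y [^] (p ^ e)) [^] p" if "y \<in> carrier R" for y
    using that by (simp add: nat_pow_pow mult.commute)
  then show ?case
    using a b Suc frobenius_add_prime[OF p char] by simp
qed

text \<open>Positivity of \<open>p\<close> matters: the value \<open>0\<close> of the characteristic means that no positive multiple
of the unit vanishes.\<close>

lemma ring_characteristic_add_pow:
  assumes "ring_characteristic R = p" and "p > 0"
  shows "add_pow R (p :: nat) \<one>\<^bsub>R\<^esub> = \<zero>\<^bsub>R\<^esub>"
proof -
  have ex: "\<exists>n>0. add_pow R (n::nat) \<one>\<^bsub>R\<^esub> = \<zero>\<^bsub>R\<^esub>"
    using assms by (auto simp: ring_characteristic_def split: if_splits)
  then have "p = (LEAST n. n > 0 \<and> add_pow R n \<one>\<^bsub>R\<^esub> = \<zero>\<^bsub>R\<^esub>)"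
    using assms(1) by (simp add: ring_characteristic_def)
  with LeastI_ex[OF ex] show ?thesis by simp
qed

section \<open>Frobenius stability of the mixed powers\<close>

lemma ideals_set_one [simp]: "\<one>\<^bsub>ideals_set R\<^esub> = carrier R"
  by (simp add: ideals_set_def)

lemma ideals_set_mult [simp]: "I \<otimes>\<^bsub>ideals_set R\<^esub> J = ideal_prod R I J"
  by (simp add: ideals_set_def)

lemma ideal_pow_0 [simp]: "I [^]\<^bsub>ideals_set R\<^esub> (0::nat) = carrier R"
  by (simp add: nat_pow_def)

lemma ideal_pow_Suc [simp]:
  "I [^]\<^bsub>ideals_set R\<^esub> Suc n = ideal_prod R (I [^]\<^bsub>ideals_set R\<^esub> n) I"
  by (simp add: nat_pow_def)

lemma (in ring) ideal_pow_ideal: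
  fixes n :: nat
  assumes "ideal I R"
  shows "ideal (I [^]\<^bsub>ideals_set R\<^esub> n) R"
  by (induction n) (simp_all add: oneideal ideal_prod_is_ideal assms)

lemma (in ring) ideal_pow_antimono:
  fixes m n :: nat
  assumes "ideal I R" and "m \<le> n"
  shows "I [^]\<^bsub>ideals_set R\<^esub> n \<subseteq> I [^]\<^bsub>ideals_set R\<^esub> m"
  using assms(2)
proof (induction n rule: dec_induct)
  case (step n)
  then show ?case
    using ideal_prod_inter[OF ideal_pow_ideal[OF assms(1), of n] assms(1)]
    by auto
qed simp

lemma (in cring) pow_mem_ideal_pow:
  fixes m k :: nat
  assumes I: "ideal I R" and y: "y \<in> I [^]\<^bsub>ideals_set R\<^esub> m"
  shows "y [^] k \<in> I [^]\<^bsub>ideals_set R\<^esub> (m * k)"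
proof (induction k)
  case 0
  then show ?case by simp
next
  case (Suc k)
  interpret ideals: semiring "ideals_set R" by (rule ideals_set_is_semiring)
  have "I \<in> carrier (ideals_set R)" using I by (simp add: ideals_set_def)
  then have "I [^]\<^bsub>ideals_set R\<^esub> (m * Suc k)
      = ideal_prod R (I [^]\<^bsub>ideals_set R\<^esub> (m * k)) (I [^]\<^bsub>ideals_set R\<^esub> m)"
    using ideals.nat_pow_mult[of I "m * k" m] by (simp add: ideals_set_def add.commute)
  with Suc y show ?case by (simp add: ideal_prod.prod)
qed

lemma (in cring) frobenius_power_ideal:
  assumes "ideal I R"
  shows "ideal (frobenius_power R I q) R"
  unfolding frobenius_power_def
  using ideal.Icarr[OF assms] by (intro genideal_ideal) auto

lemma (in cring) mixed_power_ideal: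
  assumes "ideal I R"
  shows "ideal (mixed_power R I s q) R"
  unfolding mixed_power_def
  by (intro add_ideals ideal_pow_ideal frobenius_power_ideal assms)

text \<open>By additivity of Frobenius, the elements whose \<open>p\<^sup>e\<close>-th power lies in the target ideal
form an ideal themselves, so it is enough to look at the generators \<open>f\<^sup>q\<close>.\<close>

lemma (in cring) pow_mem_frobenius_power:
  fixes p e q :: nat
  assumes p: "Factorial_Ring.prime p" and char: "add_pow R p \<one> = \<zero>"
    and I: "ideal I R" and y: "y \<in> frobenius_power R I q"
  shows "y [^] (p ^ e) \<in> frobenius_power R I (q * p ^ e)"
proof -
  let ?F = "frobenius_power R I (q * p ^ e)"
  interpret F: ideal ?F R by (rule frobenius_power_ideal[OF I])
  define J where "J = {y \<in> carrier R. y [^] (p ^ e) \<in> ?F}"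
  have pos: "p ^ e > 0" using p by (simp add: prime_gt_0_nat)
  have mult: "x \<otimes> a \<in> J" if "a \<in> J" "x \<in> carrier R" for a x
    using that by (simp add: J_def nat_pow_distrib F.I_l_closed)
  have "ideal J R"
  proof (rule idealI)
    show "subgroup J (add_monoid R)"
    proof (rule add.subgroupI)
      show "J \<subseteq> carrier R" by (auto simp: J_def)
      have "\<zero> \<in> J" using pos by (simp add: J_def nat_pow_zero)
      then show "J \<noteq> {}" by blast
      show "\<ominus> a \<in> J" if "a \<in> J" for a
        using mult[OF that, of "\<ominus> \<one>"] that by (simp add: J_def l_minus)
      show "a \<oplus> b \<in> J" if "a \<in> J" "b \<in> J" for a b
        using that by (simp add: J_def frobenius_add[OF p char] F.a_closed)
    qed
    show "x \<otimes> a \<in> J" if "a \<in> J" "x \<in> carrier R" for a x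
      by (rule mult[OF that])
    show "a \<otimes> x \<in> J" if "a \<in> J" "x \<in> carrier R" for a x
      using mult[OF that] that by (simp add: J_def m_comm)
  qed (rule ring_axioms)
  moreover have "{f [^] q |f. f \<in> I} \<subseteq> J"
  proof clarify
    fix f assume f: "f \<in> I"
    then have fc: "f \<in> carrier R" by (rule ideal.Icarr[OF I])
    have "{f [^] (q * p ^ e) |f. f \<in> I} \<subseteq> ?F"
      unfolding frobenius_power_def using ideal.Icarr[OF I] by (intro genideal_self) auto
    with f fc show "f [^] q \<in> J" by (auto simp: J_def nat_pow_pow)
  qed
  ultimately have "frobenius_power R I q \<subseteq> J"
    unfolding frobenius_power_def by (rule genideal_minimal)
  with y show ?thesis by (auto simp: J_def)
qed

text \<open>This is what allows a membership at exponent \<open>q\<close> to be transported to exponent \<open>q p\<^sup>e\<close>.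
On the ordinary power it rests on \<open>\<lceil>s q p\<^sup>e\<rceil> \<le> \<lceil>s q\<rceil> p\<^sup>e\<close>: raising to the \<open>p\<^sup>e\<close>-th
power lands in an ideal power at least as deep as required.\<close>

lemma (in cring) pow_mem_mixed_power:
  fixes p e q :: nat
  assumes p: "Factorial_Ring.prime p" and char: "add_pow R p \<one> = \<zero>"
    and I: "ideal I R" and s: "s \<ge> 0" and y: "y \<in> mixed_power R I s q"
  shows "y [^] (p ^ e) \<in> mixed_power R I s (q * p ^ e)"
proof -
  obtain a b where a: "a \<in> I [^]\<^bsub>ideals_set R\<^esub> nat \<lceil>s * real q\<rceil>"
    and b: "b \<in> frobenius_power R I q" and yab: "y = a \<oplus> b"
    using y by (auto simp: mixed_power_def set_add_def')
  have carr: "a \<in> carrier R" "b \<in> carrier R"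
    using ideal.Icarr[OF ideal_pow_ideal[OF I] a] ideal.Icarr[OF frobenius_power_ideal[OF I] b]
    by auto
  have "s * real (q * p ^ e) \<le> real (nat \<lceil>s * real q\<rceil> * p ^ e)"
  proof -
    have "s * real q \<le> real (nat \<lceil>s * real q\<rceil>)" by linarith
    then have "s * real q * real (p ^ e) \<le> real (nat \<lceil>s * real q\<rceil>) * real (p ^ e)"
      by (rule mult_right_mono) simp
    then show ?thesis by (simp add: mult.assoc)
  qed
  then have "nat \<lceil>s * real (q * p ^ e)\<rceil> \<le> nat \<lceil>s * real q\<rceil> * p ^ e"
    by linarith
  from ideal_pow_antimono[OF I this] pow_mem_ideal_pow[OF I a, of "p ^ e"]
  have "a [^] (p ^ e) \<in> I [^]\<^bsub>ideals_set R\<^esub> nat \<lceil>s * real (q * p ^ e)\<rceil>" by blast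
  moreover have "b [^] (p ^ e) \<in> frobenius_power R I (q * p ^ e)"
    by (rule pow_mem_frobenius_power[OF p char I b])
  ultimately show ?thesis
    unfolding yab frobenius_add[OF p char carr] mixed_power_def set_add_def' by blast
qed


section \<open>Images of mixed powers under surjective homomorphisms\<close>

lemma (in ring_hom_ring) image_ideal:
  assumes surj: "h ` carrier R = carrier S" and I: "ideal I R"
  shows "ideal (h ` I) S"
proof -
  interpret I: ideal I R by (rule I)
  show ?thesis
  proof (rule idealI)
    show "subgroup (h ` I) (add_monoid S)"
      by (rule img_is_add_subgroup[OF I.a_subgroup])
  next
    fix a x assume "a \<in> h ` I" "x \<in> carrier S"
    then obtain i r where ir: "i \<in> I" "r \<in> carrier R" "a = h i" "x = h r" using surj by blast
    then have "x \<otimes>\<^bsub>S\<^esub> a = h (r \<otimes> i)" "a \<otimes>\<^bsub>S\<^esub> x = h (i \<otimes> r)" using I.Icarr by simp_all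
    with ir show "x \<otimes>\<^bsub>S\<^esub> a \<in> h ` I" "a \<otimes>\<^bsub>S\<^esub> x \<in> h ` I"
      using I.I_l_closed I.I_r_closed by blast+
  qed (rule S.ring_axioms)
qed

text \<open>One inclusion holds because the preimage of the ideal on the right contains \<open>A\<close>, the other because
surjectivity makes the image of an ideal an ideal.\<close>

lemma (in ring_hom_ring) image_genideal:
  assumes surj: "h ` carrier R = carrier S" and A: "A \<subseteq> carrier R"
  shows "h ` (Idl\<^bsub>R\<^esub> A) = Idl\<^bsub>S\<^esub> (h ` A)"
proof
  have hA: "h ` A \<subseteq> carrier S" using A by auto
  have "A \<subseteq> {r \<in> carrier R. h r \<in> Idl\<^bsub>S\<^esub> (h ` A)}"
    using A S.genideal_self[OF hA] by auto
  then have "Idl\<^bsub>R\<^esub> A \<subseteq> {r \<in> carrier R. h r \<in> Idl\<^bsub>S\<^esub> (h ` A)}"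
    by (rule R.genideal_minimal[OF ideal_vimage[OF S.genideal_ideal[OF hA]]])
  then show "h ` (Idl\<^bsub>R\<^esub> A) \<subseteq> Idl\<^bsub>S\<^esub> (h ` A)" by blast
  show "Idl\<^bsub>S\<^esub> (h ` A) \<subseteq> h ` (Idl\<^bsub>R\<^esub> A)"
    by (rule S.genideal_minimal[OF image_ideal[OF surj R.genideal_ideal[OF A]]])
      (rule image_mono[OF R.genideal_self[OF A]])
qed

lemma (in ring_hom_ring) image_set_add:
  assumes "A \<subseteq> carrier R" and "B \<subseteq> carrier R"
  shows "h ` (A <+>\<^bsub>R\<^esub> B) = h ` A <+>\<^bsub>S\<^esub> h ` B"
proof -
  have h_add: "h (a \<oplus> b) = h a \<oplus>\<^bsub>S\<^esub> h b" if "a \<in> A" "b \<in> B" for a b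
    using that assms by (intro hom_add) auto
  show ?thesis
    by (fastforce simp: set_add_def' h_add[symmetric])
qed

lemma (in ring_hom_ring) image_ideal_prod:
  assumes I: "ideal I R" and J: "ideal J R"
  shows "h ` (ideal_prod R I J) = ideal_prod S (h ` I) (h ` J)"
proof (intro subset_antisym subsetI)
  fix y assume "y \<in> h ` (ideal_prod R I J)"
  then obtain x where x: "x \<in> ideal_prod R I J" and y: "y = h x" by blast
  from x have "h x \<in> ideal_prod S (h ` I) (h ` J)"
  proof induction
    case (prod i j)
    then show ?case
      using ideal.Icarr[OF I] ideal.Icarr[OF J] by (simp add: ideal_prod.prod)
  next
    case (sum s1 s2)
    then show ?case
      using R.ideal_prod_in_carrier[OF I J] by (simp add: ideal_prod.sum subset_iff)
  qed
  with y show "y \<in> ideal_prod S (h ` I) (h ` J)" by simp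
next
  fix y assume "y \<in> ideal_prod S (h ` I) (h ` J)"
  then show "y \<in> h ` (ideal_prod R I J)"
  proof induction
    case (prod a b)
    then obtain i j where ij: "i \<in> I" "j \<in> J" "a = h i" "b = h j" by blast
    then have "a \<otimes>\<^bsub>S\<^esub> b = h (i \<otimes> j)"
      using ideal.Icarr[OF I] ideal.Icarr[OF J] by simp
    with ij show ?case by (auto intro: ideal_prod.prod)
  next
    case (sum s1 s2)
    then obtain a b where ab: "a \<in> ideal_prod R I J" "b \<in> ideal_prod R I J" "s1 = h a" "s2 = h b"
      by blast
    then have "s1 \<oplus>\<^bsub>S\<^esub> s2 = h (a \<oplus> b)"
      using R.ideal_prod_in_carrier[OF I J] by (simp add: subset_iff)
    with ab show ?case by (auto intro: ideal_prod.sum)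
  qed
qed

lemma (in ring_hom_ring) image_ideal_pow:
  fixes n :: nat
  assumes "h ` carrier R = carrier S" and "ideal I R"
  shows "h ` (I [^]\<^bsub>ideals_set R\<^esub> n) = (h ` I) [^]\<^bsub>ideals_set S\<^esub> n"
  by (induction n)
    (simp_all add: assms image_ideal_prod R.ideal_pow_ideal)

lemma (in ring_hom_ring) image_frobenius_power:
  assumes "h ` carrier R = carrier S" and I: "ideal I R"
  shows "h ` frobenius_power R I q = frobenius_power S (h ` I) q"
proof -
  have "h ` {f [^]\<^bsub>R\<^esub> q |f. f \<in> I} = {g [^]\<^bsub>S\<^esub> q |g. g \<in> h ` I}"
    using ideal.Icarr[OF I] by (force simp: hom_nat_pow)
  moreover have "{f [^]\<^bsub>R\<^esub> q |f. f \<in> I} \<subseteq> carrier R"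
    using ideal.Icarr[OF I] by auto
  ultimately show ?thesis
    unfolding frobenius_power_def using image_genideal[OF assms(1)] by simp
qed

lemma (in ring_hom_cring) image_mixed_power:
  assumes surj: "h ` carrier R = carrier S" and I: "ideal I R"
  shows "h ` mixed_power R I s q = mixed_power S (h ` I) s q"
proof -
  have "I [^]\<^bsub>ideals_set R\<^esub> n \<subseteq> carrier R" for n :: nat
    using ideal.Icarr[OF R.ideal_pow_ideal[OF I]] by blast
  moreover have "frobenius_power R I q \<subseteq> carrier R"
    using ideal.Icarr[OF R.frobenius_power_ideal[OF I]] by blast
  ultimately show ?thesis
    unfolding mixed_power_def
    by (simp add: ring.image_set_add ring.image_ideal_pow[OF surj I]
        ring.image_frobenius_power[OF surj I])
qed

lemma (in ideal) quotient_map_surj: "(+>) I ` carrier R = carrier (R Quot I)"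
  by (auto simp: FactRing_def A_RCOSETS_def RCOSETS_def a_r_coset_def)

lemma (in ring) quotient_extension_eq_image:
  assumes P: "ideal P R" and I: "ideal I R"
  shows "quotient_extension R P I = (+>) P ` I"
proof -
  interpret hom: ring_hom_ring R "R Quot P" "(+>) P"
    by (rule ideal.rcos_ring_hom_ring[OF P])
  have "ideal ((+>) P ` I) (R Quot P)"
    by (rule hom.image_ideal[OF ideal.quotient_map_surj[OF P] I])
  then show ?thesis
    unfolding quotient_extension_def
    by (intro subset_antisym hom.S.genideal_minimal hom.S.genideal_self)
      (auto dest: ideal.Icarr)
qed

text \<open>Every element of the mixed power in the quotient ring thus lifts to the mixed power in \<open>R\<close> at the
same exponent; this is how statements about \<open>R/P\<close> become congruences modulo \<open>P\<close>.\<close>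

lemma (in cring) quotient_extension_mixed_power:
  assumes P: "ideal P R" and I: "ideal I R"
  shows "mixed_power (R Quot P) (quotient_extension R P I) s q = (+>) P ` mixed_power R I s q"
proof -
  interpret hom: ring_hom_cring R "R Quot P" "(+>) P"
    by (rule ideal.rcos_ring_hom_cring[OF P is_cring])
  show ?thesis
    using hom.image_mixed_power[OF ideal.quotient_map_surj[OF P] I]
    by (simp add: quotient_extension_eq_image[OF P I])
qed

section \<open>Minimal primes of a noetherian ring\<close>

lemma (in monoid) foldr_mult_closed:
  assumes "\<And>Q. Q \<in> set Qs \<Longrightarrow> f Q \<in> carrier G"
  shows "foldr (\<otimes>) (map f Qs) \<one> \<in> carrier G"
  using assms by (intro multlist_closed) auto

lemma (in monoid) foldr_mult_append:
  assumes "\<And>Q. Q \<in> set (Qs @ Ts) \<Longrightarrow> f Q \<in> carrier G"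
  shows "foldr (\<otimes>) (map f (Qs @ Ts)) \<one>
    = foldr (\<otimes>) (map f Qs) \<one> \<otimes> foldr (\<otimes>) (map f Ts) \<one>"
  using assms
  by (induction Qs) (simp_all add: m_assoc foldr_mult_closed del: map_map)

lemma (in cring) mult_mem_ideal_of_sums:
  assumes J: "ideal J R" and a: "a \<in> carrier R" and b: "b \<in> carrier R" and ab: "a \<otimes> b \<in> J"
    and u: "u \<in> J <+>\<^bsub>R\<^esub> PIdl a" and v: "v \<in> J <+>\<^bsub>R\<^esub> PIdl b"
  shows "u \<otimes> v \<in> J"
proof -
  interpret J: ideal J R by (rule J)
  obtain j r where jr: "j \<in> J" "r \<in> carrier R" "u = j \<oplus> r \<otimes> a"
    using u by (auto simp: set_add_def' cgenideal_def)
  obtain i t where it: "i \<in> J" "t \<in> carrier R" "v = i \<oplus> t \<otimes> b"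
    using v by (auto simp: set_add_def' cgenideal_def)
  note carr = J.Icarr[OF jr(1)] J.Icarr[OF it(1)] jr(2) it(2) a b
  have "u \<otimes> v = j \<otimes> (i \<oplus> t \<otimes> b) \<oplus> (r \<otimes> a) \<otimes> i \<oplus> (r \<otimes> t) \<otimes> (a \<otimes> b)"
    unfolding jr(3) it(3) using carr by algebra
  moreover have "j \<otimes> (i \<oplus> t \<otimes> b) \<in> J" "(r \<otimes> a) \<otimes> i \<in> J" "(r \<otimes> t) \<otimes> (a \<otimes> b) \<in> J"
    using carr jr it ab by (auto intro: J.I_r_closed J.I_l_closed)
  ultimately show ?thesis by (simp add: J.a_closed)
qed

text \<open>Noetherian induction: in an ideal \<open>M\<close> maximal among the counterexamples, \<open>M\<close> is proper and not
prime, so \<open>a b \<in> M\<close> for some \<open>a, b \<notin> M\<close>. The strictly larger ideals \<open>M + (a)\<close> and \<open>M + (b)\<close> have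
lists of primes, and the concatenation of these lists works for \<open>M\<close> because
\<open>(M + (a)) (M + (b)) \<subseteq> M\<close>.

The product of the listed primes is described through products of elements, one chosen from each
prime. A choice depends on the prime only, not on its position in the list; this suffices both for
showing that every prime ideal contains a listed one and for powers of a single element.\<close>

lemma (in cring) ideal_contains_prime_product:
  assumes noeth: "noetherian_ring R" and "ideal J R"
  shows "\<exists>Qs. (\<forall>Q\<in>set Qs. primeideal Q R) \<and>
    (\<forall>f. (\<forall>Q\<in>set Qs. f Q \<in> Q) \<longrightarrow> foldr (\<otimes>) (map f Qs) \<one> \<in> J)"
proof (rule ccontr)
  let ?good = "\<lambda>J Qs. (\<forall>Q\<in>set Qs. primeideal Q R) \<and>
    (\<forall>f. (\<forall>Q\<in>set Qs. f Q \<in> Q) \<longrightarrow> foldr (\<otimes>) (map f Qs) \<one> \<in> J)"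
  define B where "B = {J. ideal J R \<and> (\<nexists>Qs. ?good J Qs)}"
  assume "\<nexists>Qs. ?good J Qs"
  with assms(2) have "B \<noteq> {}" by (auto simp: B_def)
  moreover have "\<Union>C \<in> B" if "C \<noteq> {}" and C: "subset.chain B C" for C
  proof -
    have "subset.chain {I. ideal I R} C" using C by (auto simp: subset_chain_def B_def)
    then have "\<Union>C \<in> C"
      by (rule noetherian_ring.ideal_chain_is_trivial[OF noeth \<open>C \<noteq> {}\<close>])
    moreover have "C \<subseteq> B" using C by (simp add: subset_chain_def)
    ultimately show ?thesis by (rule subsetD[rotated])
  qed
  ultimately have "\<exists>M\<in>B. \<forall>N\<in>B. M \<subseteq> N \<longrightarrow> N = M"
    by (rule subset_Zorn_nonempty)
  then obtain M where M: "M \<in> B" and max: "\<And>N. N \<in> B \<Longrightarrow> M \<subseteq> N \<Longrightarrow> N = M"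
    by blast
  have idM: "ideal M R" and bad: "\<nexists>Qs. ?good M Qs" using M unfolding B_def by blast+
  interpret M: ideal M R by (rule idM)
  have "\<not> primeideal M R"
  proof
    assume "primeideal M R"
    then have "?good M [M]" using M.Icarr by auto
    with bad show False by blast
  qed
  moreover have "carrier R \<noteq> M"
  proof
    assume "carrier R = M"
    then have "?good M []" by auto
    with bad show False by blast
  qed
  ultimately obtain a b where a: "a \<in> carrier R" "a \<notin> M" and b: "b \<in> carrier R" "b \<notin> M"
    and ab: "a \<otimes> b \<in> M"
    using primeidealI[OF idM is_cring] by blast
  have larger: "\<exists>Qs. ?good (M <+>\<^bsub>R\<^esub> PIdl y) Qs" if y: "y \<in> carrier R" "y \<notin> M" for y
  proof -
    have id: "ideal (M <+>\<^bsub>R\<^esub> PIdl y) R"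
      by (rule add_ideals[OF idM cgenideal_ideal[OF y(1)]])
    have sub: "M \<union> PIdl y \<subseteq> M <+>\<^bsub>R\<^esub> PIdl y"
      unfolding union_genideal[OF idM cgenideal_ideal[OF y(1)], symmetric]
      by (rule genideal_self)
        (use M.Icarr ideal.Icarr[OF cgenideal_ideal[OF y(1)]] in blast)
    have "M <+>\<^bsub>R\<^esub> PIdl y \<noteq> M"
      using sub cgenideal_self[OF y(1)] y(2) by blast
    with max[of "M <+>\<^bsub>R\<^esub> PIdl y"] sub have "M <+>\<^bsub>R\<^esub> PIdl y \<notin> B" by blast
    with id show ?thesis unfolding B_def by blast
  qed
  obtain Qs Ts where Qs: "?good (M <+>\<^bsub>R\<^esub> PIdl a) Qs" and Ts: "?good (M <+>\<^bsub>R\<^esub> PIdl b) Ts"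
    using larger[OF a] larger[OF b] by blast
  have "?good M (Qs @ Ts)"
  proof (intro conjI allI impI)
    show "\<forall>Q\<in>set (Qs @ Ts). primeideal Q R" using Qs Ts by auto
    fix f assume f: "\<forall>Q\<in>set (Qs @ Ts). f Q \<in> Q"
    have carr: "f Q \<in> carrier R" if "Q \<in> set (Qs @ Ts)" for Q
    proof -
      have "ideal Q R" using Qs Ts that by (auto dest: primeideal.axioms(1))
      with f that show ?thesis by (auto intro: ideal.Icarr)
    qed
    have "foldr (\<otimes>) (map f Qs) \<one> \<in> M <+>\<^bsub>R\<^esub> PIdl a"
        "foldr (\<otimes>) (map f Ts) \<one> \<in> M <+>\<^bsub>R\<^esub> PIdl b"
      using Qs Ts f by auto
    moreover have "foldr (\<otimes>) (map f (Qs @ Ts)) \<one>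
        = foldr (\<otimes>) (map f Qs) \<one> \<otimes> foldr (\<otimes>) (map f Ts) \<one>"
      by (rule foldr_mult_append) (rule carr)
    ultimately show "foldr (\<otimes>) (map f (Qs @ Ts)) \<one> \<in> M"
      using mult_mem_ideal_of_sums[OF idM a(1) b(1) ab] by metis
  qed
  with bad show False by blast
qed

lemma (in primeideal) foldr_mult_notin:
  assumes "\<And>Q. Q \<in> set Qs \<Longrightarrow> f Q \<in> carrier R - I"
  shows "foldr (\<otimes>) (map f Qs) \<one> \<in> carrier R - I"
  using assms
proof (induction Qs)
  case Nil
  then show ?case using I_notcarr one_imp_carrier by auto
next
  case (Cons Q Qs)
  then have "f Q \<in> carrier R - I" "foldr (\<otimes>) (map f Qs) \<one> \<in> carrier R - I" by simp_all
  then show ?case using I_prime[of "f Q" "foldr (\<otimes>) (map f Qs) \<one>"] by auto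
qed

text \<open>If a product of listed primes vanishes, then every prime ideal contains a listed prime. Hence the
minimal primes occur in the list, and each listed prime contains a minimal one. An element \<open>y\<close> of
all minimal primes therefore lies in every listed prime, so \<open>y\<close> to the length of the list is zero.
The exponent is the same for all such \<open>y\<close>.\<close>

lemma (in cring) noetherian_minimal_primes:
  assumes "noetherian_ring R"
  shows finite_minimal_primes: "finite {P. minimal_prime P R}"
    and minimal_primes_inter_nilpotent:
      "\<exists>m::nat. \<forall>y\<in>carrier R. (\<forall>P. minimal_prime P R \<longrightarrow> y \<in> P) \<longrightarrow> y [^] m = \<zero>"
proof -
  obtain Qs where prime: "\<And>Q. Q \<in> set Qs \<Longrightarrow> primeideal Q R"
    and prod: "\<And>f. (\<And>Q. Q \<in> set Qs \<Longrightarrow> f Q \<in> Q) \<Longrightarrow> foldr (\<otimes>) (map f Qs) \<one> = \<zero>"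
    using ideal_contains_prime_product[OF assms zeroideal] by (metis singletonD)
  have below: "\<exists>Q\<in>set Qs. Q \<subseteq> P" if P: "primeideal P R" for P
  proof (rule ccontr)
    interpret P: primeideal P R by (rule P)
    assume "\<not> (\<exists>Q\<in>set Qs. Q \<subseteq> P)"
    then have "\<forall>Q\<in>set Qs. \<exists>a. a \<in> Q \<and> a \<notin> P" by blast
    then obtain f where f: "\<And>Q. Q \<in> set Qs \<Longrightarrow> f Q \<in> Q \<and> f Q \<notin> P" by metis
    then have "f Q \<in> carrier R - P" if "Q \<in> set Qs" for Q
      using that ideal.Icarr[OF primeideal.axioms(1)[OF prime]] by blast
    then have "foldr (\<otimes>) (map f Qs) \<one> \<notin> P" using P.foldr_mult_notin by blast
    with prod f P.zero_closed show False by metis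
  qed
  have "{P. minimal_prime P R} \<subseteq> set Qs"
  proof clarify
    fix P assume P: "minimal_prime P R"
    then obtain Q where "Q \<in> set Qs" "Q \<subseteq> P" by (metis below minimal_prime_def)
    with P prime show "P \<in> set Qs" by (auto simp: minimal_prime_def)
  qed
  then show "finite {P. minimal_prime P R}" by (rule finite_subset) simp
  have above: "\<exists>P. minimal_prime P R \<and> P \<subseteq> Q" if "Q \<in> set Qs" for Q
  proof -
    let ?A = "{Q' \<in> set Qs. Q' \<subseteq> Q}"
    have "finite ?A" "?A \<noteq> {}" using that by auto
    then have "\<exists>P\<in>?A. \<forall>Q'\<in>?A. Q' \<subseteq> P \<longrightarrow> P = Q'"
      by (rule finite_has_minimal)
    then obtain P where P: "P \<in> ?A" and min: "\<forall>Q'\<in>?A. Q' \<subseteq> P \<longrightarrow> P = Q'"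
      by (rule bexE)
    have "T = P" if T: "primeideal T R" "T \<subseteq> P" for T
    proof -
      obtain Q' where Q': "Q' \<in> set Qs" "Q' \<subseteq> T" using below[OF T(1)] by blast
      with T(2) P have "Q' \<in> ?A" "Q' \<subseteq> P" by auto
      with min have "P = Q'" by simp
      with Q' T(2) show ?thesis by simp
    qed
    then have "minimal_prime P R" using P prime by (auto simp: minimal_prime_def)
    with P show ?thesis by blast
  qed
  have "y [^] length Qs = \<zero>" if y: "\<forall>P. minimal_prime P R \<longrightarrow> y \<in> P" "y \<in> carrier R" for y
  proof -
    have "foldr (\<otimes>) (map (\<lambda>_. y) Ts) \<one> = y [^] length Ts" for Ts :: "'a set list"
      using y(2) by (induction Ts) (simp_all add: m_comm)
    moreover have "y \<in> Q" if "Q \<in> set Qs" for Q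
      using above[OF that] y(1) by blast
    ultimately show ?thesis using prod[of "\<lambda>_. y"] by simp
  qed
  then show "\<exists>m::nat. \<forall>y\<in>carrier R. (\<forall>P. minimal_prime P R \<longrightarrow> y \<in> P) \<longrightarrow> y [^] m = \<zero>"
    by blast
qed

text \<open>A product of elements outside a prime ideal, one from each \<open>Q\<close>, stays outside that prime.\<close>

lemma (in primeideal) prime_avoids_inter:
  assumes "finite S" and "\<And>Q. Q \<in> S \<Longrightarrow> ideal Q R" and "\<And>Q. Q \<in> S \<Longrightarrow> \<not> Q \<subseteq> I"
  shows "\<exists>t \<in> carrier R - I. \<forall>Q\<in>S. t \<in> Q"
  using assms
proof (induction S)
  case empty
  then show ?case using I_notcarr one_imp_carrier by blast
next
  case (insert Q S)
  then obtain t where t: "t \<in> carrier R - I" "\<forall>Q\<in>S. t \<in> Q" by auto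
  obtain a where a: "a \<in> Q" "a \<notin> I" using insert.prems(2)[of Q] by blast
  have ac: "a \<in> carrier R" using a insert.prems(1)[of Q] by (auto dest: ideal.Icarr)
  have "a \<otimes> t \<in> carrier R - I" using t a ac I_prime by auto
  moreover have "a \<otimes> t \<in> T" if "T \<in> insert Q S" for T
    using that insert.prems(1)[OF that] t a ac
    by (auto intro: ideal.I_l_closed ideal.I_r_closed)
  ultimately show ?case by blast
qed

section \<open>Multipliers modulo minimal primes\<close>

lemma (in primeideal) quotient_map_eq_zero_iff:
  assumes "a \<in> carrier R"
  shows "I +> a = \<zero>\<^bsub>R Quot I\<^esub> \<longleftrightarrow> a \<in> I"
  using assms a_rcos_zero[OF is_ideal] rcos_const_imp_mem by (auto simp: FactRing_def)

lemma (in domain) off_minimal_primes_domain: "off_minimal_primes R = carrier R - {\<zero>}"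
proof -
  have "minimal_prime P R \<longleftrightarrow> P = {\<zero>}" for P
  proof
    assume "minimal_prime P R"
    then have "primeideal P R" and min: "\<And>Q. primeideal Q R \<Longrightarrow> Q \<subseteq> P \<Longrightarrow> Q = P"
      by (auto simp: minimal_prime_def)
    then interpret P: primeideal P R by simp
    show "P = {\<zero>}" using min[OF zeroprimeideal] P.zero_closed by auto
  next
    assume P: "P = {\<zero>}"
    have "Q = P" if "primeideal Q R" "Q \<subseteq> P" for Q
    proof -
      interpret Q: primeideal Q R by (rule that)
      show ?thesis using that(2) Q.zero_closed P by auto
    qed
    with P show "minimal_prime P R" using zeroprimeideal by (auto simp: minimal_prime_def)
  qed
  then show ?thesis by (auto simp: off_minimal_primes_def)
qed

lemma (in cring) off_minimal_primes_pow:
  fixes n :: nat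
  assumes "c \<in> off_minimal_primes R"
  shows "c [^] n \<in> off_minimal_primes R"
proof -
  have c: "c \<in> carrier R" and notin: "\<And>P. minimal_prime P R \<Longrightarrow> c \<notin> P"
    using assms by (auto simp: off_minimal_primes_def)
  have "c [^] n \<notin> P" if P: "minimal_prime P R" for P
  proof -
    interpret P: primeideal P R using P by (simp add: minimal_prime_def)
    show ?thesis
    proof (induction n)
      case 0
      then show ?case using P.I_notcarr P.one_imp_carrier by auto
    next
      case (Suc n)
      then show ?case using P.I_prime[of "c [^] n" c] c notin[OF P] by auto
    qed
  qed
  with c show ?thesis by (simp add: off_minimal_primes_def)
qed

text \<open>The quotient by a prime is a domain, where the admissible multipliers are exactly the nonzero
elements; they lift to the elements outside the prime.\<close>

lemma (in primeideal) mem_weak_closure_quotient_iff: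
  assumes J: "ideal J R" and x: "x \<in> carrier R"
  shows "I +> x \<in> weak_closure p (R Quot I) s (quotient_extension R I J) \<longleftrightarrow>
    (\<exists>c\<in>carrier R - I. \<exists>q0. \<forall>q\<ge>q0. (\<exists>e>0. q = p ^ e) \<longrightarrow>
       (\<exists>y\<in>mixed_power R J s q. c \<otimes> x [^] q \<ominus> y \<in> I))"
proof -
  interpret Q: domain "R Quot I" by (rule quotient_is_domain)
  interpret hom: ring_hom_cring R "R Quot I" "(+>) I" by (rule rcos_ring_hom_cring)
  have mem: "(I +> c) \<otimes>\<^bsub>R Quot I\<^esub> (I +> x) [^]\<^bsub>R Quot I\<^esub> q
        \<in> mixed_power (R Quot I) (quotient_extension R I J) s q
      \<longleftrightarrow> (\<exists>y\<in>mixed_power R J s q. c \<otimes> x [^] q \<ominus> y \<in> I)" if c: "c \<in> carrier R" for c q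
  proof -
    have "(I +> c) \<otimes>\<^bsub>R Quot I\<^esub> (I +> x) [^]\<^bsub>R Quot I\<^esub> q = I +> (c \<otimes> x [^] q)"
      using c x by (simp add: hom.ring.hom_nat_pow)
    moreover have "I +> (c \<otimes> x [^] q) = I +> y \<longleftrightarrow> c \<otimes> x [^] q \<ominus> y \<in> I"
      if "y \<in> mixed_power R J s q" for y
      using c x ideal.Icarr[OF mixed_power_ideal[OF J] that]
      by (intro quotient_eq_iff_same_a_r_cos[OF is_ideal, symmetric]) auto
    ultimately show ?thesis
      unfolding quotient_extension_mixed_power[OF is_ideal J] by auto
  qed
  have off: "off_minimal_primes (R Quot I) = (+>) I ` (carrier R - I)"
    unfolding Q.off_minimal_primes_domain
    using quotient_map_surj quotient_map_eq_zero_iff by (auto simp: image_iff)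
  let ?mem = "\<lambda>c q. c \<otimes>\<^bsub>R Quot I\<^esub> (I +> x) [^]\<^bsub>R Quot I\<^esub> q
    \<in> mixed_power (R Quot I) (quotient_extension R I J) s q"
  have "I +> x \<in> weak_closure p (R Quot I) s (quotient_extension R I J) \<longleftrightarrow>
      (\<exists>c\<in>off_minimal_primes (R Quot I). \<exists>q0. \<forall>q\<ge>q0. (\<exists>e>0. q = p ^ e) \<longrightarrow> ?mem c q)"
    using hom.hom_closed[OF x] by (simp only: weak_closure_def mem_Collect_eq simp_thms)
  also have "\<dots> \<longleftrightarrow> (\<exists>c\<in>carrier R - I. \<exists>q0. \<forall>q\<ge>q0. (\<exists>e>0. q = p ^ e) \<longrightarrow> ?mem (I +> c) q)"
    unfolding off by (rule bex_simps)
  also have "\<dots> \<longleftrightarrow> (\<exists>c\<in>carrier R - I. \<exists>q0. \<forall>q\<ge>q0. (\<exists>e>0. q = p ^ e) \<longrightarrow>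
       (\<exists>y\<in>mixed_power R J s q. c \<otimes> x [^] q \<ominus> y \<in> I))"
    by (rule bex_cong) (simp_all only: mem DiffD1)
  finally show ?thesis .
qed

text \<open>Gluing in the style of the Chinese remainder theorem. A multiplier \<open>c\<close> that works modulo one
member \<open>P\<close> is multiplied by some \<open>t \<notin> P\<close> that lies in all other members. The product
\<open>t c\<close> still avoids \<open>P\<close>, and it works modulo every member at once: modulo \<open>P\<close> by the choice of \<open>c\<close>, and
modulo the others because everything vanishes there. The sum of these products avoids
every \<open>P \<in> M\<close>, since all summands but one lie in \<open>P\<close>.

In the application the filter \<open>F\<close> expresses ``for all large powers of \<open>p\<close>''.\<close>

lemma (in cring) glue_multipliers:
  assumes fin: "finite M" and prime: "\<And>P. P \<in> M \<Longrightarrow> primeideal P R"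
    and incomparable: "\<And>P Q. P \<in> M \<Longrightarrow> Q \<in> M \<Longrightarrow> Q \<subseteq> P \<Longrightarrow> Q = P"
    and J: "\<And>q. ideal (J q) R" and x: "x \<in> carrier R"
    and mult: "\<And>P. P \<in> M \<Longrightarrow> \<exists>c\<in>carrier R - P. \<forall>\<^sub>F q in F. \<exists>y\<in>J q. c \<otimes> x [^] (q::nat) \<ominus> y \<in> P"
  shows "\<exists>c\<in>carrier R. (\<forall>P\<in>M. c \<notin> P) \<and>
    (\<forall>\<^sub>F q in F. \<exists>y\<in>J q. \<forall>P\<in>M. c \<otimes> x [^] q \<ominus> y \<in> P)"
proof -
  define good where "good c \<longleftrightarrow> c \<in> carrier R \<and>
    (\<forall>\<^sub>F q in F. \<exists>y\<in>J q. \<forall>P\<in>M. c \<otimes> x [^] q \<ominus> y \<in> P)" for c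
  have local: "\<exists>d. good d \<and> d \<notin> P \<and> (\<forall>Q\<in>M - {P}. d \<in> Q)" if P: "P \<in> M" for P
  proof -
    interpret P: primeideal P R by (rule prime[OF P])
    obtain c where c: "c \<in> carrier R" "c \<notin> P"
      and ev: "\<forall>\<^sub>F q in F. \<exists>y\<in>J q. c \<otimes> x [^] q \<ominus> y \<in> P"
      using mult[OF P] by blast
    have "\<exists>t\<in>carrier R - P. \<forall>Q\<in>M - {P}. t \<in> Q"
      using fin prime incomparable[OF P]
      by (intro P.prime_avoids_inter) (auto dest: primeideal.axioms(1))
    then obtain t where t: "t \<in> carrier R" "t \<notin> P" "\<forall>Q\<in>M - {P}. t \<in> Q" by blast
    have "\<forall>\<^sub>F q in F. \<exists>y\<in>J q. \<forall>Q\<in>M. t \<otimes> c \<otimes> x [^] q \<ominus> y \<in> Q"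
      using ev
    proof (rule eventually_mono)
      fix q assume "\<exists>y\<in>J q. c \<otimes> x [^] q \<ominus> y \<in> P"
      then obtain y where y: "y \<in> J q" "c \<otimes> x [^] q \<ominus> y \<in> P" by blast
      have yc: "y \<in> carrier R" by (rule ideal.Icarr[OF J y(1)])
      have eq: "t \<otimes> c \<otimes> x [^] q \<ominus> t \<otimes> y = t \<otimes> (c \<otimes> x [^] q \<ominus> y)"
        using t c x yc by (simp add: m_assoc a_minus_def r_distr r_minus)
      have "t \<otimes> (c \<otimes> x [^] q \<ominus> y) \<in> Q" if Q: "Q \<in> M" for Q
      proof (cases "Q = P")
        case True
        then show ?thesis using y(2) t(1) P.I_l_closed by blast
      next
        case False
        then have "t \<in> Q" using t(3) Q by blast
        then show ?thesis
          using ideal.I_r_closed[OF primeideal.axioms(1)[OF prime[OF Q]]] c x yc by simp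
      qed
      then have "\<forall>Q\<in>M. t \<otimes> c \<otimes> x [^] q \<ominus> t \<otimes> y \<in> Q" by (simp add: eq)
      moreover have "t \<otimes> y \<in> J q" by (rule ideal.I_l_closed[OF J y(1) t(1)])
      ultimately show "\<exists>y\<in>J q. \<forall>Q\<in>M. t \<otimes> c \<otimes> x [^] q \<ominus> y \<in> Q" by blast
    qed
    then have "good (t \<otimes> c)" using t c by (simp add: good_def)
    moreover have "t \<otimes> c \<notin> P" using P.I_prime[OF t(1) c(1)] t(2) c(2) by blast
    moreover have "\<forall>Q\<in>M - {P}. t \<otimes> c \<in> Q"
      using t(3) c(1) prime by (auto intro!: ideal.I_r_closed dest: primeideal.axioms(1))
    ultimately show ?thesis by blast
  qed
  have add: "good (c \<oplus> d)" if c: "good c" and d: "good d" for c d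
  proof -
    have carr: "c \<in> carrier R" "d \<in> carrier R" using c d by (simp_all add: good_def)
    have "\<forall>\<^sub>F q in F. \<exists>y\<in>J q. \<forall>P\<in>M. c \<otimes> x [^] q \<ominus> y \<in> P"
      and "\<forall>\<^sub>F q in F. \<exists>y\<in>J q. \<forall>P\<in>M. d \<otimes> x [^] q \<ominus> y \<in> P"
      using c d by (simp_all add: good_def)
    then have "\<forall>\<^sub>F q in F. \<exists>y\<in>J q. \<forall>P\<in>M. (c \<oplus> d) \<otimes> x [^] q \<ominus> y \<in> P"
    proof eventually_elim
      case (elim q)
      then obtain y z where y: "y \<in> J q" "\<forall>P\<in>M. c \<otimes> x [^] q \<ominus> y \<in> P"
        and z: "z \<in> J q" "\<forall>P\<in>M. d \<otimes> x [^] q \<ominus> z \<in> P" by blast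
      have "y \<in> carrier R" "z \<in> carrier R"
        using ideal.Icarr[OF J] y(1) z(1) by blast+
      moreover have "x [^] q \<in> carrier R" using x by simp
      ultimately have eq: "(c \<oplus> d) \<otimes> x [^] q \<ominus> (y \<oplus> z)
          = (c \<otimes> x [^] q \<ominus> y) \<oplus> (d \<otimes> x [^] q \<ominus> z)"
        using carr by algebra
      have "\<forall>P\<in>M. (c \<oplus> d) \<otimes> x [^] q \<ominus> (y \<oplus> z) \<in> P"
        unfolding eq using y(2) z(2) prime
        by (auto intro!: additive_subgroup.a_closed dest!: primeideal.axioms(1) ideal.axioms(1))
      moreover have "y \<oplus> z \<in> J q"
        using y(1) z(1) J by (meson additive_subgroup.a_closed ideal.axioms(1))
      ultimately show ?case by blast
    qed
    with carr show ?thesis by (simp add: good_def)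
  qed
  \<comment> \<open>The partial sum over \<open>S\<close> avoids the members of \<open>S\<close> and lies in all others; the latter
    property is what lets the next summand be added.\<close>
  have "\<exists>c. good c \<and> (\<forall>P\<in>S. c \<notin> P) \<and> (\<forall>P\<in>M - S. c \<in> P)" if "finite S" "S \<subseteq> M" for S
    using that
  proof (induction S)
    case empty
    have "good \<zero>"
    proof -
      have "\<zero> \<otimes> x [^] q \<ominus> \<zero> \<in> P" if "P \<in> M" for P and q :: nat
      proof -
        interpret P: primeideal P R by (rule prime[OF that])
        show ?thesis using x by (simp add: a_minus_def)
      qed
      moreover have "\<zero> \<in> J q" for q
        using J by (meson additive_subgroup.zero_closed ideal.axioms(1))
      ultimately show ?thesis by (auto simp: good_def intro!: always_eventually)
    qed
    moreover have "\<forall>P\<in>M. \<zero> \<in> P"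
      using prime by (meson additive_subgroup.zero_closed ideal.axioms(1) primeideal.axioms(1))
    ultimately show ?case by auto
  next
    case (insert P S)
    then obtain c where c: "good c" "\<forall>Q\<in>S. c \<notin> Q" "\<forall>Q\<in>M - S. c \<in> Q" by auto
    obtain d where d: "good d" "d \<notin> P" "\<forall>Q\<in>M - {P}. d \<in> Q" using local[of P] insert.prems by auto
    have carr: "c \<in> carrier R" "d \<in> carrier R" using c(1) d(1) by (simp_all add: good_def)
    have mem: "c \<oplus> d \<in> Q \<longleftrightarrow> (c \<in> Q \<longleftrightarrow> d \<in> Q)" if Q: "Q \<in> M" "c \<in> Q \<or> d \<in> Q" for Q
    proof -
      interpret Q: primeideal Q R by (rule prime[OF Q(1)])
      have "c = (c \<oplus> d) \<ominus> d" "d = (c \<oplus> d) \<ominus> c" using carr by algebra+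
      then show ?thesis
        using Q(2) Q.a_closed Q.a_inv_closed unfolding a_minus_def by metis
    qed
    have "c \<oplus> d \<notin> Q" if "Q \<in> insert P S" for Q
      using mem[of Q] that c d insert.hyps insert.prems by (cases "Q = P") auto
    moreover have "c \<oplus> d \<in> Q" if "Q \<in> M - insert P S" for Q
      using mem[of Q] that c d by auto
    ultimately show ?case using add[OF c(1) d(1)] by blast
  qed
  from this[OF fin subset_refl] show ?thesis by (auto simp: good_def)
qed

section \<open>The weak closure modulo minimal primes\<close>

theorem theorem4p6:
  fixes R :: "('a, 'b) ring_scheme" and I :: "'a set" and p :: nat and s :: real and x :: 'a
  assumes "cring R" and "noetherian_ring R"
    and "Factorial_Ring.prime p" and "ring_characteristic R = p"
    and "ideal I R" and "s \<ge> 1" and "x \<in> carrier R"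
  shows "x \<in> weak_closure p R s I \<longleftrightarrow>
    (\<forall>P. minimal_prime P R \<longrightarrow>
       P +>\<^bsub>R\<^esub> x \<in> weak_closure p (R Quot P) s (quotient_extension R P I))"
proof -
  interpret cring R by (rule assms(1))
  note p = assms(3) and I = assms(5) and x = assms(7)
  have char: "add_pow R p \<one>\<^bsub>R\<^esub> = \<zero>\<^bsub>R\<^esub>"
    using ring_characteristic_add_pow[OF assms(4)] p by (simp add: prime_gt_0_nat)
  let ?J = "mixed_power R I s"
  have J: "ideal (?J q) R" for q by (rule mixed_power_ideal[OF I])
  have quot: "P +>\<^bsub>R\<^esub> x \<in> weak_closure p (R Quot P) s (quotient_extension R P I) \<longleftrightarrow>
      (\<exists>c\<in>carrier R - P. \<exists>q0. \<forall>q\<ge>q0. (\<exists>e>0. q = p ^ e) \<longrightarrow>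
         (\<exists>y\<in>?J q. c \<otimes>\<^bsub>R\<^esub> x [^]\<^bsub>R\<^esub> q \<ominus>\<^bsub>R\<^esub> y \<in> P))" if "minimal_prime P R" for P
    using that by (intro primeideal.mem_weak_closure_quotient_iff I x) (simp add: minimal_prime_def)
  show ?thesis
  proof (intro iffI allI impI)
    fix P assume "x \<in> weak_closure p R s I" and P: "minimal_prime P R"
    then obtain c q0 where c: "c \<in> carrier R" "c \<notin> P"
      and mem: "\<And>q. q \<ge> q0 \<Longrightarrow> \<exists>e>0. q = p ^ e \<Longrightarrow> c \<otimes>\<^bsub>R\<^esub> x [^]\<^bsub>R\<^esub> q \<in> ?J q"
      by (auto simp: weak_closure_def off_minimal_primes_def)
    interpret P: primeideal P R using P by (simp add: minimal_prime_def)
    have "c \<otimes>\<^bsub>R\<^esub> x [^]\<^bsub>R\<^esub> q \<ominus>\<^bsub>R\<^esub> c \<otimes>\<^bsub>R\<^esub> x [^]\<^bsub>R\<^esub> q \<in> P" for q :: nat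
      using c x by (simp add: a_minus_def r_neg)
    with c mem show "P +>\<^bsub>R\<^esub> x \<in> weak_closure p (R Quot P) s (quotient_extension R P I)"
      unfolding quot[OF P] by blast
  next
    assume all: "\<forall>P. minimal_prime P R \<longrightarrow>
      P +>\<^bsub>R\<^esub> x \<in> weak_closure p (R Quot P) s (quotient_extension R P I)"
    \<comment> \<open>The filter of large powers of \<open>p\<close>.\<close>
    define F where "F = inf at_top (principal {q. \<exists>e>0. q = p ^ e})"
    have F: "eventually A F \<longleftrightarrow> (\<exists>q0. \<forall>q\<ge>q0. (\<exists>e>0. q = p ^ e) \<longrightarrow> A q)" for A
      by (simp add: F_def eventually_inf_principal eventually_at_top_linorder)
    let ?M = "{P. minimal_prime P R}"
    have "\<exists>c\<in>carrier R. (\<forall>P\<in>?M. c \<notin> P) \<and>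
        (\<forall>\<^sub>F q in F. \<exists>y\<in>?J q. \<forall>P\<in>?M. c \<otimes>\<^bsub>R\<^esub> x [^]\<^bsub>R\<^esub> q \<ominus>\<^bsub>R\<^esub> y \<in> P)"
    proof (rule glue_multipliers[OF finite_minimal_primes[OF assms(2)] _ _ J x])
      fix P assume "P \<in> {P. minimal_prime P R}"
      then have P: "minimal_prime P R" by simp
      then show "primeideal P R" by (simp add: minimal_prime_def)
      show "\<exists>c\<in>carrier R - P. \<forall>\<^sub>F q in F. \<exists>y\<in>?J q. c \<otimes>\<^bsub>R\<^esub> x [^]\<^bsub>R\<^esub> q \<ominus>\<^bsub>R\<^esub> y \<in> P"
        using all P quot[OF P] by (simp add: F)
    qed (auto simp: minimal_prime_def)
    then obtain c where cc: "c \<in> carrier R" and cP: "\<forall>P\<in>?M. c \<notin> P"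
      and ev: "\<forall>\<^sub>F q in F. \<exists>y\<in>?J q. \<forall>P\<in>?M. c \<otimes>\<^bsub>R\<^esub> x [^]\<^bsub>R\<^esub> q \<ominus>\<^bsub>R\<^esub> y \<in> P"
      by blast
    have c: "c \<in> off_minimal_primes R" using cc cP by (simp add: off_minimal_primes_def)
    obtain q0 where mod_nil: "\<forall>q\<ge>q0. (\<exists>e>0. q = p ^ e) \<longrightarrow>
        (\<exists>y\<in>?J q. \<forall>P\<in>?M. c \<otimes>\<^bsub>R\<^esub> x [^]\<^bsub>R\<^esub> q \<ominus>\<^bsub>R\<^esub> y \<in> P)"
      using ev unfolding F ..
    obtain m :: nat where nil: "\<forall>y\<in>carrier R. (\<forall>P. minimal_prime P R \<longrightarrow> y \<in> P)
        \<longrightarrow> y [^]\<^bsub>R\<^esub> m = \<zero>\<^bsub>R\<^esub>"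
      using minimal_primes_inter_nilpotent[OF assms(2)] ..
    have p1: "1 < p" by (rule prime_gt_1_nat[OF p])
    have m_le: "m \<le> p ^ m" using less_exp[of m] power_mono[of 2 p m] p1 by linarith
    \<comment> \<open>A power of \<open>p\<close> that is at least \<open>m\<close>: raising to it is additive and sends the
      intersection of the minimal primes to zero.\<close>
    let ?r = "p ^ m"
    \<comment> \<open>The summand \<open>p\<close> in the threshold keeps the exponent of \<open>q' = q / p\<^sup>m\<close> positive.\<close>
    have "(c [^]\<^bsub>R\<^esub> ?r) \<otimes>\<^bsub>R\<^esub> x [^]\<^bsub>R\<^esub> q \<in> ?J q"
      if q: "q \<ge> (q0 + p) * ?r" "\<exists>e>0. q = p ^ e" for q
    proof -
      obtain e where e: "q = p ^ e" using q(2) by blast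
      have "p ^ Suc m \<le> (q0 + p) * ?r" by (simp add: add_mult_distrib)
      with q(1) e have "p ^ Suc m \<le> p ^ e" by linarith
      then have "Suc m \<le> e" using p1 power_le_imp_le_exp by blast
      define q' where "q' = p ^ (e - m)"
      have qq': "q = q' * ?r"
        using \<open>Suc m \<le> e\<close> by (simp add: q'_def e flip: power_add)
      have "(q0 + p) * ?r \<le> q' * ?r" using q(1) by (simp only: qq')
      then have "q0 \<le> q'" using p1 by simp
      moreover have "\<exists>e>0. q' = p ^ e" unfolding q'_def
        using \<open>Suc m \<le> e\<close> by (intro exI[of _ "e - m"]) simp
      ultimately obtain y where y: "y \<in> ?J q'"
        and diff: "\<forall>P\<in>?M. c \<otimes>\<^bsub>R\<^esub> x [^]\<^bsub>R\<^esub> q' \<ominus>\<^bsub>R\<^esub> y \<in> P"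
        using mod_nil by blast
      have yc: "y \<in> carrier R" by (rule ideal.Icarr[OF J y])
      define n where "n = c \<otimes>\<^bsub>R\<^esub> x [^]\<^bsub>R\<^esub> q' \<ominus>\<^bsub>R\<^esub> y"
      have nc: "n \<in> carrier R" using cc x yc by (simp add: n_def)
      have "n [^]\<^bsub>R\<^esub> ?r = n [^]\<^bsub>R\<^esub> m \<otimes>\<^bsub>R\<^esub> n [^]\<^bsub>R\<^esub> (?r - m)"
        using nc m_le by (simp add: nat_pow_mult)
      also have "\<dots> = \<zero>\<^bsub>R\<^esub>" using nil nc diff by (simp add: n_def)
      finally have n_pow: "n [^]\<^bsub>R\<^esub> ?r = \<zero>\<^bsub>R\<^esub>" .
      have "c \<otimes>\<^bsub>R\<^esub> x [^]\<^bsub>R\<^esub> q' = n \<oplus>\<^bsub>R\<^esub> y"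
        using cc x yc by (simp add: n_def a_minus_def a_assoc l_neg)
      then have "(c \<otimes>\<^bsub>R\<^esub> x [^]\<^bsub>R\<^esub> q') [^]\<^bsub>R\<^esub> ?r = y [^]\<^bsub>R\<^esub> ?r"
        using frobenius_add[OF p char nc yc] yc by (simp add: n_pow)
      moreover have "(c \<otimes>\<^bsub>R\<^esub> x [^]\<^bsub>R\<^esub> q') [^]\<^bsub>R\<^esub> ?r = (c [^]\<^bsub>R\<^esub> ?r) \<otimes>\<^bsub>R\<^esub> x [^]\<^bsub>R\<^esub> q"
        using cc x by (simp add: nat_pow_distrib nat_pow_pow qq')
      moreover have "y [^]\<^bsub>R\<^esub> ?r \<in> ?J q"
        unfolding qq' using assms(6) by (intro pow_mem_mixed_power[OF p char I _ y]) simp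
      ultimately show ?thesis by simp
    qed
    with off_minimal_primes_pow[OF c, of ?r] x show "x \<in> weak_closure p R s I"
      by (auto simp: weak_closure_def)
  qed
qed

end
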